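(* Let $\mathbf{k}$ be a field of characteristic $0$, $\lambda\in\mathbf{k}$, $(\mathfrak{g},[-,-],T)$ a Rota-Baxter Lie algebra of weight $\lambda$ and $(M,\rho,T_M)$ a Rota-Baxter Lie representation over it. Define $\Phi^0=\mathrm{id}_M$ and, for $n\ge1$ and $f\in\mathrm{Hom}(\wedge^n\mathfrak{g},M)$, $$\Phi^n(f)(x_1\wedge\cdots\wedge x_n)=f(T(x_1)\wedge\cdots\wedge T(x_n))-\sum_{k=0}^{n-1}\ \sum_{1\le i_1<\cdots<i_k\le n}\lambda^{n-k-1}\,T_M\big(f(y_1\wedge\cdots\wedge y_n)\big),$$ where, for each choice of $i_1<\dots<i_k$, $y_i=T(x_i)$ if $i\in\{i_1,\dots,i_k\}$ and $y_i=x_i$ otherwise. Then $\Phi^\bullet:\mathrm{C}^\bullet_{\mathrm{Lie}}(\mathfrak{g},M)\to\mathrm{C}^\bullet_{\mathrm{RBLO}_\lambda}(\mathfrak{g},M)$ is a chain map, i.e. $\Phi^{n+1}\circ\delta^n=\partial^n\circ\Phi^n$ for all $n\ge0$.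
   Context: A Rota-Baxter Lie algebra of weight $\lambda$ is a Lie algebra $(\mathfrak{g},[-,-])$ with a linear map $T:\mathfrak{g}\to\mathfrak{g}$ satisfying $[T(a),T(b)]=T([a,T(b)]+[T(a),b]+\lambda[a,b])$. A Rota-Baxter Lie representation $(M,\rho,T_M)$ is a Lie representation $(M,\rho)$ of $\mathfrak{g}$, $a\cdot m=\rho(a)(m)$, with a linear map $T_M:M\to M$ such that $T(a)\cdot T_M(m)=T_M(a\cdot T_M(m)+T(a)\cdot m+\lambda\,a\cdot m)$ for all $a\in\mathfrak{g}$, $m\in M$. $\mathrm{C}^\bullet_{\mathrm{Lie}}(\mathfrak{g},M)$ is the Chevalley-Eilenberg complex: $\mathrm{C}^n_{\mathrm{Lie}}(\mathfrak{g},M)=\mathrm{Hom}(\wedge^n\mathfrak{g},M)$, $n\ge0$, with $$\delta^n(f)(x_1\wedge\cdots\wedge x_{n+1})=\sum_{i=1}^{n+1}(-1)^{n+i}x_i\cdot f(x_1\wedge\cdots\wedge\widehat{x_i}\wedge\cdots\wedge x_{n+1})+\sum_{1\le i<j\le n+1}(-1)^{i+j+n+1}f([x_i,x_j]\wedge x_1\wedge\cdots\wedge\widehat{x_i}\wedge\cdots\wedge\widehat{x_j}\wedge\cdots\wedge x_{n+1}).$$ $\mathrm{C}^\bullet_{\mathrm{RBLO}_\lambda}(\mathfrak{g},M)$ is the Chevalley-Eilenberg complex (same sign conventions), with differential denoted $\partial^\bullet$, of the descendent Lie algebra $\mathfrak{g}_\star$, i.e. $\mathfrak{g}$ with bracket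 $[a,b]_\star=[a,T(b)]+[T(a),b]+\lambda[a,b]$, with coefficients in the representation ${}_\rhd M$, i.e. $M$ with action $a\rhd m=T(a)\cdot m-T_M(a\cdot m)$. Thus $\mathrm{C}^n_{\mathrm{RBLO}_\lambda}(\mathfrak{g},M)=\mathrm{Hom}(\wedge^n\mathfrak{g},M)$ and $\partial^n$ is given by the formula for $\delta^n$ with $[-,-]$ replaced by $[-,-]_\star$ and $\cdot$ by $\rhd$. *)

theory Defs
  imports Complex_Main
begin

section \<open>Lie algebras and Lie representations\<close>

locale lie_algebra = vector_space scale
  for scale :: "'k::field \<Rightarrow> 'g::ab_group_add \<Rightarrow> 'g" +
  fixes bracket :: "'g \<Rightarrow> 'g \<Rightarrow> 'g"
  assumes bracket_linear_left: "Vector_Spaces.linear scale scale (\<lambda>a. bracket a b)"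
    and bracket_linear_right: "Vector_Spaces.linear scale scale (\<lambda>b. bracket a b)"
    and bracket_self: "bracket a a = 0"
    and jacobi: "bracket a (bracket b c) + bracket b (bracket c a) + bracket c (bracket a b) = 0"

locale lie_representation =
  lie_algebra scaleG bracket + M: vector_space scaleM
  for scaleG :: "'k::field \<Rightarrow> 'g::ab_group_add \<Rightarrow> 'g"
    and bracket :: "'g \<Rightarrow> 'g \<Rightarrow> 'g"
    and scaleM :: "'k \<Rightarrow> 'm::ab_group_add \<Rightarrow> 'm" +
  fixes act :: "'g \<Rightarrow> 'm \<Rightarrow> 'm"
  assumes act_linear_left: "Vector_Spaces.linear scaleG scaleM (\<lambda>a. act a m)"
    and act_linear_right: "Vector_Spaces.linear scaleM scaleM (\<lambda>m. act a m)"
    and act_bracket: "act (bracket a b) m = act a (act b m) - act b (act a m)"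

section \<open>Rota-Baxter Lie algebras and representations\<close>

definition descendent_bracket ::
  "('k \<Rightarrow> 'g::ab_group_add \<Rightarrow> 'g) \<Rightarrow> ('g \<Rightarrow> 'g \<Rightarrow> 'g) \<Rightarrow> 'k \<Rightarrow> ('g \<Rightarrow> 'g) \<Rightarrow> 'g \<Rightarrow> 'g \<Rightarrow> 'g"
  where "descendent_bracket scaleG bracket lam T a b =
    bracket a (T b) + bracket (T a) b + scaleG lam (bracket a b)"

definition descendent_act ::
  "('g \<Rightarrow> 'm::ab_group_add \<Rightarrow> 'm) \<Rightarrow> ('g \<Rightarrow> 'g) \<Rightarrow> ('m \<Rightarrow> 'm) \<Rightarrow> 'g \<Rightarrow> 'm \<Rightarrow> 'm"
  where "descendent_act act T TM a m = act (T a) m - TM (act a m)"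

locale rota_baxter_lie_algebra = lie_algebra scaleG bracket
  for scaleG :: "'k::field \<Rightarrow> 'g::ab_group_add \<Rightarrow> 'g"
    and bracket :: "'g \<Rightarrow> 'g \<Rightarrow> 'g" +
  fixes lam :: 'k and T :: "'g \<Rightarrow> 'g"
  assumes T_linear: "Vector_Spaces.linear scaleG scaleG T"
    and rota_baxter: "bracket (T a) (T b) =
      T (bracket a (T b) + bracket (T a) b + scaleG lam (bracket a b))"

locale rota_baxter_lie_representation =
  rota_baxter_lie_algebra scaleG bracket lam T + lie_representation scaleG bracket scaleM act
  for scaleG :: "'k::field \<Rightarrow> 'g::ab_group_add \<Rightarrow> 'g"
    and bracket :: "'g \<Rightarrow> 'g \<Rightarrow> 'g"
    and lam :: 'k and T :: "'g \<Rightarrow> 'g"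
    and scaleM :: "'k \<Rightarrow> 'm::ab_group_add \<Rightarrow> 'm"
    and act :: "'g \<Rightarrow> 'm \<Rightarrow> 'm" +
  fixes TM :: "'m \<Rightarrow> 'm"
  assumes TM_linear: "Vector_Spaces.linear scaleM scaleM TM"
    and rota_baxter_act: "act (T a) (TM m) =
      TM (act a (TM m) + act (T a) m + scaleM lam (act a m))"

lemma (in rota_baxter_lie_algebra) descendent_lie_algebra:
  "lie_algebra scaleG (descendent_bracket scaleG bracket lam T)"
proof -
  interpret Tl: Vector_Spaces.linear scaleG scaleG T by (rule T_linear)
  interpret bl: Vector_Spaces.linear scaleG scaleG "\<lambda>a. bracket a b" for b
    by (rule bracket_linear_left)
  interpret br: Vector_Spaces.linear scaleG scaleG "\<lambda>b. bracket a b" for a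
    by (rule bracket_linear_right)
  note lin = Tl.add Tl.scale bl.add bl.scale br.add br.scale
  have anti: "bracket a b = - bracket b a" for a b
  proof -
    have "0 = bracket (a + b) (a + b)" by (simp only: bracket_self)
    also have "\<dots> = bracket a b + bracket b a"
      by (simp only: bl.add br.add) (simp add: bracket_self add.commute)
    finally show ?thesis by (simp add: eq_neg_iff_add_eq_0)
  qed
  have rb': "T (descendent_bracket scaleG bracket lam T a b) = bracket (T a) (T b)" for a b
    unfolding descendent_bracket_def by (rule rota_baxter[symmetric])
  show ?thesis
  proof
    fix a b c x y r
    show "descendent_bracket scaleG bracket lam T (x + y) b =
      descendent_bracket scaleG bracket lam T x b + descendent_bracket scaleG bracket lam T y b"
      by (simp add: descendent_bracket_def lin algebra_simps)
    show "descendent_bracket scaleG bracket lam T (scaleG r b) c =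
      scaleG r (descendent_bracket scaleG bracket lam T b c)"
      by (simp add: descendent_bracket_def lin algebra_simps)
    show "descendent_bracket scaleG bracket lam T a (x + y) =
      descendent_bracket scaleG bracket lam T a x + descendent_bracket scaleG bracket lam T a y"
      by (simp add: descendent_bracket_def lin algebra_simps)
    show "descendent_bracket scaleG bracket lam T a (scaleG r b) =
      scaleG r (descendent_bracket scaleG bracket lam T a b)"
      by (simp add: descendent_bracket_def lin algebra_simps)
    show "descendent_bracket scaleG bracket lam T a a = 0"
      using anti[of a "T a"] by (simp add: descendent_bracket_def bracket_self)
    have step: "descendent_bracket scaleG bracket lam T a (descendent_bracket scaleG bracket lam T b c) =
        bracket a (bracket (T b) (T c))
      + (bracket (T a) (bracket b (T c)) + bracket (T a) (bracket (T b) c)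
         + scaleG lam (bracket (T a) (bracket b c)))
      + (scaleG lam (bracket a (bracket b (T c))) + scaleG lam (bracket a (bracket (T b) c))
         + scaleG lam (scaleG lam (bracket a (bracket b c))))" for a b c
      unfolding descendent_bracket_def[of _ _ _ _ a] rb'
      by (simp add: descendent_bracket_def lin scale_right_distrib)
    define J where "J a b c =
      bracket a (bracket b c) + bracket b (bracket c a) + bracket c (bracket a b)" for a b c
    have J0: "J a b c = 0" for a b c
      unfolding J_def by (rule jacobi)
    have "descendent_bracket scaleG bracket lam T a (descendent_bracket scaleG bracket lam T b c)
      + descendent_bracket scaleG bracket lam T b (descendent_bracket scaleG bracket lam T c a)
      + descendent_bracket scaleG bracket lam T c (descendent_bracket scaleG bracket lam T a b)
      = J a (T b) (T c) + J (T a) b (T c) + J (T a) (T b) c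
        + scaleG lam (J (T a) b c) + scaleG lam (J a (T b) c) + scaleG lam (J a b (T c))
        + scaleG lam (scaleG lam (J a b c))"
      unfolding step J_def by (simp only: scale_right_distrib add_ac)
    then show "descendent_bracket scaleG bracket lam T a (descendent_bracket scaleG bracket lam T b c)
      + descendent_bracket scaleG bracket lam T b (descendent_bracket scaleG bracket lam T c a)
      + descendent_bracket scaleG bracket lam T c (descendent_bracket scaleG bracket lam T a b) = 0"
      by (simp add: J0)
  qed
qed

lemma (in rota_baxter_lie_representation) descendent_lie_representation:
  "lie_representation scaleG (descendent_bracket scaleG bracket lam T) scaleM (descendent_act act T TM)"
proof -
  interpret D: lie_algebra scaleG "descendent_bracket scaleG bracket lam T"
    by (rule descendent_lie_algebra)
  interpret Tl: Vector_Spaces.linear scaleG scaleG T by (rule T_linear)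
  interpret TMl: Vector_Spaces.linear scaleM scaleM TM by (rule TM_linear)
  interpret al: Vector_Spaces.linear scaleG scaleM "\<lambda>a. act a m" for m
    by (rule act_linear_left)
  interpret ar: Vector_Spaces.linear scaleM scaleM "\<lambda>m. act a m" for a
    by (rule act_linear_right)
  note lin = Tl.add Tl.scale TMl.add TMl.scale TMl.diff al.add al.scale ar.add ar.scale ar.diff
  have rb': "T (descendent_bracket scaleG bracket lam T a b) = bracket (T a) (T b)" for a b
    unfolding descendent_bracket_def by (rule rota_baxter[symmetric])
  show ?thesis
  proof
    fix a b x y m m' r
    show "descendent_act act T TM (x + y) m = descendent_act act T TM x m + descendent_act act T TM y m"
      by (simp add: descendent_act_def lin)
    show "descendent_act act T TM (scaleG r b) m = scaleM r (descendent_act act T TM b m)"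
      by (simp add: descendent_act_def lin M.scale_right_diff_distrib)
    show "descendent_act act T TM a (m + m') = descendent_act act T TM a m + descendent_act act T TM a m'"
      by (simp add: descendent_act_def lin)
    show "descendent_act act T TM a (scaleM r m) = scaleM r (descendent_act act T TM a m)"
      by (simp add: descendent_act_def lin M.scale_right_diff_distrib)
    show "descendent_act act T TM (descendent_bracket scaleG bracket lam T a b) m =
      descendent_act act T TM a (descendent_act act T TM b m)
      - descendent_act act T TM b (descendent_act act T TM a m)"
      unfolding descendent_act_def rb'
      by (simp add: descendent_bracket_def lin act_bracket rota_baxter_act
          M.scale_right_diff_distrib)
  qed
qed

section \<open>Chevalley-Eilenberg cochains and differential\<close>

text \<open>
  A linear map from the \<open>n\<close>-th exterior power of \<open>\<gg>\<close> to \<open>M\<close> is an alternating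
  \<open>n\<close>-linear map. It is encoded as a function on lists, where only the values at lists of length
  \<open>n\<close> matter; the other values are fixed to be \<open>0\<close>, so that two cochains are equal iff
  the linear maps they encode are. In degree \<open>0\<close>, the element \<open>m\<close> of \<open>M\<close>
  corresponds to the cochain with value \<open>m\<close> at \<open>[]\<close>.
\<close>

definition ce_cochains ::
  "('k::field \<Rightarrow> 'g::ab_group_add \<Rightarrow> 'g) \<Rightarrow> ('k \<Rightarrow> 'm::ab_group_add \<Rightarrow> 'm)
    \<Rightarrow> nat \<Rightarrow> ('g list \<Rightarrow> 'm) set"
  where "ce_cochains scaleG scaleM n =
    {f. (\<forall>xs. length xs = n \<longrightarrow>
            (\<forall>i<n. Vector_Spaces.linear scaleG scaleM (\<lambda>x. f (xs[i := x]))))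
      \<and> (\<forall>xs. length xs = n \<longrightarrow>
            (\<forall>i j. i < j \<and> j < n \<and> xs ! i = xs ! j \<longrightarrow> f xs = 0))
      \<and> (\<forall>xs. length xs \<noteq> n \<longrightarrow> f xs = 0)}"

text \<open>
  Positions in a list count from \<open>0\<close>, so the sign exponents \<open>n + i\<close> and
  \<open>i + j + n + 1\<close> of the usual formula with indices from \<open>1\<close> to \<open>n + 1\<close>
  become \<open>n + (i + 1)\<close> and \<open>(i + 1) + (j + 1) + n + 1\<close>.
  The list \<open>nths xs (- I)\<close> is \<open>xs\<close> with the entries at positions in \<open>I\<close> removed.
\<close>

definition ce_diff ::
  "('k::field \<Rightarrow> 'm::ab_group_add \<Rightarrow> 'm) \<Rightarrow> ('g \<Rightarrow> 'g \<Rightarrow> 'g) \<Rightarrow> ('g \<Rightarrow> 'm \<Rightarrow> 'm)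
    \<Rightarrow> nat \<Rightarrow> ('g list \<Rightarrow> 'm) \<Rightarrow> 'g list \<Rightarrow> 'm"
  where "ce_diff scaleM bracket act n f xs =
    (if length xs = n + 1 then
       (\<Sum>i\<in>{..<n + 1}. scaleM ((- 1) ^ (n + (i + 1))) (act (xs ! i) (f (nths xs (- {i})))))
     + (\<Sum>(i, j)\<in>{(i, j). i < j \<and> j < n + 1}.
          scaleM ((- 1) ^ ((i + 1) + (j + 1) + n + 1))
            (f (bracket (xs ! i) (xs ! j) # nths xs (- {i, j}))))
     else 0)"

section \<open>Cochain maps and the comparison map\<close>

definition cochain_map ::
  "('k::field \<Rightarrow> 'm::ab_group_add \<Rightarrow> 'm)
    \<Rightarrow> (nat \<Rightarrow> ('g list \<Rightarrow> 'm) set) \<Rightarrow> (nat \<Rightarrow> ('g list \<Rightarrow> 'm) \<Rightarrow> 'g list \<Rightarrow> 'm)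
    \<Rightarrow> (nat \<Rightarrow> ('g list \<Rightarrow> 'm) set) \<Rightarrow> (nat \<Rightarrow> ('g list \<Rightarrow> 'm) \<Rightarrow> 'g list \<Rightarrow> 'm)
    \<Rightarrow> (nat \<Rightarrow> ('g list \<Rightarrow> 'm) \<Rightarrow> 'g list \<Rightarrow> 'm) \<Rightarrow> bool"
  where "cochain_map scaleM C d C' d' \<Phi> \<longleftrightarrow>
    (\<forall>n. \<forall>f\<in>C n. \<Phi> n f \<in> C' n)
    \<and> (\<forall>n. \<forall>f\<in>C n. \<forall>h\<in>C n. \<Phi> n (\<lambda>xs. f xs + h xs) = (\<lambda>xs. \<Phi> n f xs + \<Phi> n h xs))
    \<and> (\<forall>n c. \<forall>f\<in>C n. \<Phi> n (\<lambda>xs. scaleM c (f xs)) = (\<lambda>xs. scaleM c (\<Phi> n f xs)))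
    \<and> (\<forall>n. \<forall>f\<in>C n. \<Phi> (n + 1) (d n f) = d' n (\<Phi> n f))"

text \<open>A choice of indices \<open>i\<^sub>1 < \<dots> < i\<^sub>k\<close> is encoded as the set \<open>I\<close> of these indices.\<close>

definition apply_at :: "('g \<Rightarrow> 'g) \<Rightarrow> nat set \<Rightarrow> 'g list \<Rightarrow> 'g list"
  where "apply_at T I xs = map (\<lambda>i. if i \<in> I then T (xs ! i) else xs ! i) [0..<length xs]"

definition rb_Phi ::
  "('k::field \<Rightarrow> 'm::ab_group_add \<Rightarrow> 'm) \<Rightarrow> 'k \<Rightarrow> ('g \<Rightarrow> 'g) \<Rightarrow> ('m \<Rightarrow> 'm)
    \<Rightarrow> nat \<Rightarrow> ('g list \<Rightarrow> 'm) \<Rightarrow> 'g list \<Rightarrow> 'm"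
  where "rb_Phi scaleM lam T TM n f =
    (if n = 0 then f
     else (\<lambda>xs. if length xs = n then
         f (map T xs)
         - (\<Sum>k\<in>{0..n - 1}. \<Sum>I\<in>{I. I \<subseteq> {..<n} \<and> card I = k}.
              scaleM (lam ^ (n - k - 1)) (TM (f (apply_at T I xs))))
       else 0))"

end

theory Submission
  imports Defs
begin

text \<open>
  The map \<open>\<Phi>\<close> is a pull-back along a Lie algebra homomorphism followed by a push-forward along
  a homomorphism of representations, and this is why it commutes with the differentials.

  Let \<open>R = k[\<epsilon>]/(\<epsilon>\<^sup>2 - \<lambda> \<epsilon>)\<close> and extend scalars, \<open>\<gg>[\<epsilon>] = R \<otimes> \<gg>\<close> and \<open>M[\<epsilon>] = R \<otimes> M\<close>. Since
  \<open>[Ta + \<epsilon>a, Tb + \<epsilon>b] = [Ta, Tb] + \<epsilon> ([a, Tb] + [Ta, b] + \<lambda>[a, b])\<close>, the Rota-Baxter identity says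
  exactly that \<open>T + \<epsilon>\<close> is a Lie homomorphism from the descendent Lie algebra \<open>\<gg>\<^sub>\<star>\<close> to \<open>\<gg>[\<epsilon>]\<close>.
  It makes \<open>M[\<epsilon>]\<close> a representation of \<open>\<gg>\<^sub>\<star>\<close>, and the Rota-Baxter identity for \<open>M\<close> says that
  \<open>m + \<epsilon> m' \<mapsto> m - T\<^sub>M m'\<close> is a homomorphism from it to \<open>M\<close> with the action \<open>\<rhd>\<close>
  (lemma \<open>act_star_minus_TM\<close>).

  Extend an alternating map \<open>f\<close> to \<open>\<gg>[\<epsilon>]\<close> by \<open>R\<close>-multilinearity. Expanding, with
  \<open>\<epsilon>\<^sup>p = \<lambda>\<^sup>p\<^sup>-\<^sup>1 \<epsilon>\<close> for \<open>p \<ge> 1\<close>, shows that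
  \<open>f (T x\<^sub>1 + \<epsilon> x\<^sub>1, \<dots>, T x\<^sub>n + \<epsilon> x\<^sub>n) = f (T x\<^sub>1, \<dots>, T x\<^sub>n) + \<epsilon> S f (x\<^sub>1, \<dots>, x\<^sub>n)\<close>, where \<open>S f\<close> is the
  sum over proper subsets of the positions that occurs in \<open>\<Phi>\<close>
  (lemma \<open>eps_coeff_eq_sum_proper_subsets\<close>). Hence \<open>\<Phi> f = f \<circ> T - T\<^sub>M \<circ> S f\<close> is the
  pull-back along the first homomorphism followed by the push-forward along the second, in degree \<open>0\<close> as well.

  No scalars are extended in the formal proof: it works with the two coefficients of an element of
  \<open>M[\<epsilon>]\<close>. The coefficient of \<open>1\<close> is \<open>f \<circ> T\<close>, and everything about the coefficient \<open>S f\<close> follows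
  from the recursion that splits off the argument at one position (lemma \<open>eps_coeff_ins\<close>).
  Lemma \<open>eps_coeff_ce_diff\<close> is the \<open>\<epsilon>\<close>-part of the statement that pull-back along \<open>T + \<epsilon>\<close>
  commutes with the differentials.
\<close>

section \<open>Inserting and deleting a list entry\<close>

definition ins :: "nat \<Rightarrow> 'a \<Rightarrow> 'a list \<Rightarrow> 'a list" where
  "ins i x ys = take i ys @ x # drop i ys"

definition del :: "nat \<Rightarrow> 'a list \<Rightarrow> 'a list" where
  "del i xs = take i xs @ drop (Suc i) xs"

lemma ins_0 [simp]: "ins 0 x ys = x # ys"
  and ins_Suc_Cons [simp]: "ins (Suc i) x (y # ys) = y # ins i x ys"
  by (simp_all add: ins_def)

lemma length_ins [simp]: "length (ins i x ys) = Suc (length ys)"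
  by (simp add: ins_def)

lemma length_del: "i < length xs \<Longrightarrow> length (del i xs) = length xs - 1"
  by (simp add: del_def)

lemma nth_ins_same: "i \<le> length ys \<Longrightarrow> ins i x ys ! i = x"
  by (simp add: ins_def nth_append)

lemma nth_ins_above: "i \<le> j \<Longrightarrow> j < length ys \<Longrightarrow> ins i x ys ! Suc j = ys ! j"
  by (simp add: ins_def nth_append min_def Suc_diff_le)

lemma update_ins: "i \<le> length ys \<Longrightarrow> (ins i x ys)[i := y] = ins i y ys"
  by (simp add: ins_def list_update_append)

lemma ins_del: "i < length xs \<Longrightarrow> ins i (xs ! i) (del i xs) = xs"
  by (simp add: ins_def del_def id_take_nth_drop[symmetric])

lemma del_ins: "i \<le> length ys \<Longrightarrow> del i (ins i x ys) = ys"
  by (simp add: ins_def del_def)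

lemma update_eq_ins: "i < length xs \<Longrightarrow> xs[i := x] = ins i x (del i xs)"
  by (simp add: ins_def del_def upd_conv_take_nth_drop)

lemma nth_del_above: "i < j \<Longrightarrow> j < length xs \<Longrightarrow> del i xs ! (j - Suc 0) = xs ! j"
  by (auto simp: del_def nth_append)

lemma map_ins: "map T (ins i x ys) = ins i (T x) (map T ys)"
  by (simp add: ins_def take_map drop_map)

lemma map_del: "map T (del i xs) = del i (map T xs)"
  by (simp add: del_def take_map drop_map)

lemma nths_Compl_singleton: "nths xs (- {i}) = del i xs"
proof (induction xs arbitrary: i)
  case Nil
  then show ?case by (simp add: del_def)
next
  case (Cons x xs)
  show ?case
  proof (cases i)
    case 0
    have "{j. Suc j \<in> - {0::nat}} = UNIV" by auto
    then show ?thesis using 0 by (simp add: nths_Cons del_def nths_all)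
  next
    case (Suc k)
    have "{j. Suc j \<in> - {Suc k}} = - {k}" by auto
    then show ?thesis using Suc Cons.IH[of k] by (simp add: nths_Cons del_def)
  qed
qed

lemma nths_Compl_pair:
  "i < j \<Longrightarrow> nths xs (- {i, j}) = del (j - 1) (del i xs)"
proof (induction xs arbitrary: i j)
  case Nil
  then show ?case by (simp add: del_def)
next
  case (Cons x xs)
  obtain m where j: "j = Suc m" using Cons.prems by (cases j) auto
  show ?case
  proof (cases i)
    case 0
    have "{l. Suc l \<in> - {0, Suc m}} = - {m}" by auto
    then show ?thesis using 0 j nths_Compl_singleton[of xs m] by (simp add: nths_Cons del_def)
  next
    case (Suc k)
    have "k < m" using Cons.prems j Suc by simp
    then obtain p where m: "m = Suc p" by (cases m) auto
    have "{l. Suc l \<in> - {Suc k, Suc m}} = - {k, m}" by auto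
    then show ?thesis using Suc j m Cons.IH[OF \<open>k < m\<close>] by (simp add: nths_Cons del_def)
  qed
qed

section \<open>The coefficient of \<open>\<epsilon>\<close>\<close>

text \<open>
  This is the coefficient of \<open>\<epsilon>\<close> in \<open>f (T x\<^sub>1 + \<epsilon> x\<^sub>1, \<dots>, T x\<^sub>n + \<epsilon> x\<^sub>n)\<close>, where \<open>\<epsilon>\<^sup>2 = \<lambda> \<epsilon>\<close>. Expanding in
  the first argument gives \<open>f (T x\<^sub>1, \<dots>) + \<epsilon> f (x\<^sub>1, \<dots>)\<close>. The remaining arguments turn these two
  terms into elements \<open>p + \<epsilon> q\<close> of \<open>M[\<epsilon>]\<close>, and \<open>\<epsilon> (p + \<epsilon> q) = \<epsilon> (p + \<lambda> q)\<close>. The recursion makes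
  sense for every function on lists, which allows inductions over arbitrary \<open>f\<close>.
\<close>

fun eps_coeff ::
  "('k::field \<Rightarrow> 'm::ab_group_add \<Rightarrow> 'm) \<Rightarrow> 'k \<Rightarrow> ('g \<Rightarrow> 'g) \<Rightarrow> ('g list \<Rightarrow> 'm) \<Rightarrow> 'g list \<Rightarrow> 'm"
  where
  "eps_coeff scaleM lam T f [] = 0"
| "eps_coeff scaleM lam T f (x # xs) =
     eps_coeff scaleM lam T (\<lambda>ys. f (T x # ys)) xs
   + scaleM lam (eps_coeff scaleM lam T (\<lambda>ys. f (x # ys)) xs)
   + f (x # map T xs)"

lemma eps_coeff_cong:
  "(\<And>ys. length ys = length xs \<Longrightarrow> f ys = g ys) \<Longrightarrow>
    eps_coeff scaleM lam T f xs = eps_coeff scaleM lam T g xs"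
proof (induction xs arbitrary: f g)
  case (Cons x xs)
  have "eps_coeff scaleM lam T (\<lambda>ys. f (y # ys)) xs = eps_coeff scaleM lam T (\<lambda>ys. g (y # ys)) xs"
    for y
    by (rule Cons.IH) (simp add: Cons.prems)
  then show ?case by (simp add: Cons.prems)
qed simp

context vector_space
begin

lemma eps_coeff_add:
  "eps_coeff scale lam T (\<lambda>ys. f ys + g ys) xs = eps_coeff scale lam T f xs + eps_coeff scale lam T g xs"
  by (induction xs arbitrary: f g) (simp_all add: scale_right_distrib)

text \<open>
  A linear operator on \<open>M\<close> extends \<open>R\<close>-linearly to \<open>M[\<epsilon>]\<close>; it acts coefficientwise.
\<close>

lemma eps_coeff_hom:
  assumes "Vector_Spaces.linear scale scale h"
  shows "eps_coeff scale lam T (\<lambda>ys. h (f ys)) xs = h (eps_coeff scale lam T f xs)"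
proof -
  interpret h: Vector_Spaces.linear scale scale h by fact
  show ?thesis by (induction xs arbitrary: f) (simp_all add: h.add h.scale h.zero)
qed

lemma eps_coeff_scale:
  "eps_coeff scale lam T (\<lambda>ys. scale c (f ys)) xs = scale c (eps_coeff scale lam T f xs)"
  by (rule eps_coeff_hom) (rule linear_scale_self)

lemma eps_coeff_zero: "eps_coeff scale lam T (\<lambda>ys. 0) xs = 0"
  by (induction xs) simp_all

lemma eps_coeff_sum:
  assumes "finite A"
  shows "eps_coeff scale lam T (\<lambda>ys. \<Sum>a\<in>A. F a ys) xs = (\<Sum>a\<in>A. eps_coeff scale lam T (F a) xs)"
  using assms by (induction A rule: finite_induct) (simp_all add: eps_coeff_zero eps_coeff_add)

text \<open>
  Since \<open>\<epsilon>\<close> is central, the arguments \<open>T x + \<epsilon> x\<close> can be expanded in any order. So the defining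
  recursion holds with any position in the role of the first one.
\<close>

lemma eps_coeff_ins:
  "i \<le> length xs \<Longrightarrow>
   eps_coeff scale lam T f (ins i x xs) =
     eps_coeff scale lam T (\<lambda>ys. f (ins i (T x) ys)) xs
   + scale lam (eps_coeff scale lam T (\<lambda>ys. f (ins i x ys)) xs)
   + f (ins i x (map T xs))"
proof (induction xs arbitrary: i f)
  case Nil
  then show ?case by simp
next
  case (Cons u us)
  show ?case
  proof (cases i)
    case 0
    then show ?thesis by simp
  next
    case (Suc k)
    then have k: "k \<le> length us" using Cons.prems by simp
    show ?thesis using Suc by (simp add: Cons.IH[OF k] map_ins scale_right_distrib add_ac)
  qed
qed

text \<open>
  Expansion in two arguments gives \<open>P + \<epsilon> (Q + \<lambda> Q')\<close>, where \<open>P\<close> has the arguments \<open>T x, T y\<close>, the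
  sum \<open>Q\<close> has \<open>x, T y\<close> and \<open>T x, y\<close>, and \<open>Q'\<close> has \<open>x, y\<close>. All three still depend on \<open>\<epsilon>\<close> through the
  other arguments, which is why \<open>Q + \<lambda> Q'\<close> contributes with both of its coefficients. If \<open>f\<close> is a
  linear function of the bracket of the two arguments, \<open>Q + \<lambda> Q'\<close> is its value at the descendent bracket.
\<close>

lemma eps_coeff_ins_ins:
  fixes lam :: 'a and T :: "'c \<Rightarrow> 'c" and f :: "'c list \<Rightarrow> 'b"
  assumes "i \<le> Suc (length zs)" and "j \<le> length zs"
  defines "E \<equiv> eps_coeff scale lam T"
  defines "F x y \<equiv> \<lambda>ys. f (ins i x (ins j y ys))"
  shows "E f (ins i x (ins j y zs)) =
     E (F (T x) (T y)) zs
   + scale lam (E (F x (T y)) zs + E (F (T x) y) zs + scale lam (E (F x y) zs))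
   + (F x (T y) (map T zs) + F (T x) y (map T zs) + scale lam (F x y (map T zs)))"
  using assms(1,2)
  by (simp add: E_def F_def eps_coeff_ins map_ins scale_right_distrib add_ac)

text \<open>
  A subset \<open>I\<close> collects the positions at which \<open>T x\<^sub>i\<close> is chosen from \<open>T x\<^sub>i + \<epsilon> x\<^sub>i\<close>. It contributes
  \<open>\<epsilon>\<^sup>p\<close> with \<open>p = n - |I|\<close>, hence \<open>\<lambda>\<^sup>p\<^sup>-\<^sup>1 \<epsilon>\<close> unless \<open>I\<close> is the full set.
\<close>

lemma eps_coeff_eq_sum_proper_subsets:
  "eps_coeff scale lam T f xs =
    (\<Sum>I\<in>{I. I \<subset> {..<length xs}}. scale (lam ^ (length xs - card I - 1)) (f (apply_at T I xs)))"
proof (induction xs arbitrary: f)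
  case Nil
  then show ?case by simp
next
  case (Cons x xs)
  define n where "n = length xs"
  let ?P = "{J. J \<subset> {..<n}}"
  let ?h = "\<lambda>I. scale (lam ^ (Suc n - card I - 1)) (f (apply_at T I (x # xs)))"
  have fin: "finite ?P" by (rule finite_subset[of _ "Pow {..<n}"]) auto
  have finJ: "finite J" if "J \<in> insert {..<n} ?P" for J
    using that by (auto intro: finite_subset[of J "{..<n}"])
  have card_lt: "card J < n" if "J \<in> ?P" for J
    using psubset_card_mono[of "{..<n}" J] that by simp
  have apply_Suc: "apply_at T (Suc ` J) (x # xs) = x # apply_at T J xs" for J
    unfolding apply_at_def by (rule nth_equalityI) (auto simp: nth_Cons less_Suc_eq_0_disj split: nat.splits simp del: upt_Suc)
  have apply_insert: "apply_at T (insert 0 (Suc ` J)) (x # xs) = T x # apply_at T J xs" for J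
    unfolding apply_at_def by (rule nth_equalityI) (auto simp: nth_Cons less_Suc_eq_0_disj split: nat.splits simp del: upt_Suc)
  have apply_full: "apply_at T {..<n} xs = map T xs"
    unfolding apply_at_def n_def by (rule nth_equalityI) auto
  \<comment> \<open>Subsets containing \<open>0\<close> give the first summand of the recursion; the others give the second
    summand and, for \<open>J\<close> the full set, the third one.\<close>
  have split: "{I. I \<subset> {..<Suc n}} = (\<lambda>J. insert 0 (Suc ` J)) ` ?P \<union> (`) Suc ` insert {..<n} ?P"
    (is "?L = ?R")
  proof (intro set_eqI iffI)
    fix I assume I: "I \<in> ?L"
    define J where "J = {j. Suc j \<in> I}"
    have eq: "I = (if 0 \<in> I then insert 0 (Suc ` J) else Suc ` J)"
      unfolding J_def by (auto simp: image_iff) (metis not0_implies_Suc)+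
    have sub: "J \<subseteq> {..<n}" using I unfolding J_def by auto
    show "I \<in> ?R"
    proof (cases "0 \<in> I")
      case True
      have "J \<noteq> {..<n}"
      proof
        assume "J = {..<n}"
        then have "I = {..<Suc n}" using eq True by (simp add: lessThan_Suc_eq_insert_0)
        then show False using I by simp
      qed
      then show ?thesis using eq True sub by auto
    next
      case False
      then show ?thesis using eq sub by auto
    qed
  next
    fix I assume "I \<in> ?R"
    then consider J where "J \<subset> {..<n}" "I = insert 0 (Suc ` J)" | J where "J \<subseteq> {..<n}" "I = Suc ` J"
      by auto
    then show "I \<in> ?L"
    proof cases
      case 1
      then obtain j where "j < n" "j \<notin> J" by auto
      then have "Suc j \<in> {..<Suc n} - I" using 1 by auto
      then show ?thesis using 1 by auto
    next
      case 2
      then have "0 \<in> {..<Suc n} - I" by auto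
      then show ?thesis using 2 by auto
    qed
  qed
  have inj1: "inj_on (\<lambda>J. insert 0 (Suc ` J)) ?P"
  proof (rule inj_onI)
    fix A B assume "insert 0 (Suc ` A) = insert 0 (Suc ` B)"
    then have "Suc ` A = Suc ` B" by (auto simp: insert_ident)
    then show "A = B" by (simp add: inj_image_eq_iff)
  qed
  have inj2: "inj_on ((`) Suc) (insert {..<n} ?P)"
    by (rule inj_onI) (simp add: inj_image_eq_iff)
  have "(\<Sum>I\<in>{I. I \<subset> {..<Suc n}}. ?h I) =
      (\<Sum>J\<in>?P. ?h (insert 0 (Suc ` J))) + (\<Sum>J\<in>insert {..<n} ?P. ?h (Suc ` J))"
    unfolding split using fin
    by (subst sum.union_disjoint) (auto simp: sum.reindex[OF inj1] sum.reindex[OF inj2, simplified])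
  also have "(\<Sum>J\<in>?P. ?h (insert 0 (Suc ` J))) = eps_coeff scale lam T (\<lambda>ys. f (T x # ys)) xs"
    unfolding Cons.IH n_def[symmetric] apply_insert
    by (rule sum.cong) (use finJ in \<open>auto simp: card_image\<close>)
  also have "(\<Sum>J\<in>insert {..<n} ?P. ?h (Suc ` J)) =
      f (x # map T xs) + (\<Sum>J\<in>?P. ?h (Suc ` J))"
    using fin by (simp add: apply_Suc apply_full card_image)
  also have "(\<Sum>J\<in>?P. ?h (Suc ` J)) = scale lam (eps_coeff scale lam T (\<lambda>ys. f (x # ys)) xs)"
    unfolding Cons.IH n_def[symmetric] apply_Suc scale_sum_right
  proof (rule sum.cong)
    fix J assume J: "J \<in> ?P"
    have "Suc n - card (Suc ` J) - 1 = Suc (n - card J - 1)"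
      using card_lt[OF J] finJ J by (simp add: card_image)
    then show "scale (lam ^ (Suc n - card (Suc ` J) - 1)) (f (x # apply_at T J xs)) =
        scale lam (scale (lam ^ (n - card J - 1)) (f (x # apply_at T J xs)))"
      by simp
  qed simp
  finally show ?case unfolding n_def by (simp add: add_ac)
qed

end

section \<open>Alternating multilinear maps and the differential\<close>

lemma cochain_linear:
  assumes "f \<in> ce_cochains scaleG scaleM (Suc (length ys))" and "i \<le> length ys"
  shows "Vector_Spaces.linear scaleG scaleM (\<lambda>x. f (ins i x ys))"
proof -
  have "Vector_Spaces.linear scaleG scaleM (\<lambda>x. f ((ins i 0 ys)[i := x]))"
    using assms unfolding ce_cochains_def by simp
  then show ?thesis using assms(2) by (simp add: update_ins)
qed

lemma cochain_alternating:
  assumes "f \<in> ce_cochains scaleG scaleM (Suc (Suc (length ys)))" and "i \<le> j" and "j \<le> length ys"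
  shows "f (ins i x (ins j x ys)) = 0"
proof -
  let ?xs = "ins i x (ins j x ys)"
  have "f zs = 0"
    if "length zs = Suc (Suc (length ys))" "a < b" "b < Suc (Suc (length ys))" "zs ! a = zs ! b" for zs a b
    using assms(1) that unfolding ce_cochains_def by blast
  from this[of ?xs i "Suc j"] show ?thesis
    using assms(2,3) by (simp add: nth_ins_same nth_ins_above)
qed

lemma cochain_antisymmetric:
  assumes "f \<in> ce_cochains scaleG scaleM (Suc (Suc (length ys)))" and "i \<le> j" and "j \<le> length ys"
  shows "f (ins i x (ins j y ys)) + f (ins i y (ins j x ys)) = 0"
proof -
  have outer: "f (ins i (a + b) (ins j c ys)) = f (ins i a (ins j c ys)) + f (ins i b (ins j c ys))"
    for a b c
  proof -
    interpret l: Vector_Spaces.linear scaleG scaleM "\<lambda>x. f (ins i x (ins j c ys))"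
      by (rule cochain_linear) (use assms in auto)
    show ?thesis by (rule l.add)
  qed
  have inner: "f (ins i c (ins j (a + b) ys)) = f (ins i c (ins j a ys)) + f (ins i c (ins j b ys))"
    for a b c
  proof -
    define zs where "zs = ins i c ys"
    have *: "ins i c (ins j a ys) = ins (Suc j) a zs" for a
      using assms(2,3) unfolding zs_def
      by (auto simp: ins_def min_def Suc_diff_le drop_take)
    interpret l: Vector_Spaces.linear scaleG scaleM "\<lambda>x. f (ins (Suc j) x zs)"
      by (rule cochain_linear) (use assms in \<open>auto simp: zs_def\<close>)
    show ?thesis unfolding * by (rule l.add)
  qed
  have "0 = f (ins i (x + y) (ins j (x + y) ys))"
    using cochain_alternating[OF assms] by simp
  also have "\<dots> = f (ins i x (ins j y ys)) + f (ins i y (ins j x ys))"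
    by (simp only: outer inner) (simp add: cochain_alternating[OF assms])
  finally show ?thesis by (rule sym)
qed

text \<open>
  The two entries removed in a bracket term are taken out one after the other, so that
  everything about one position applies twice. After the removal of entry \<open>i\<close>, entry \<open>j\<close> sits at
  position \<open>j - 1\<close>.
\<close>

lemma ce_diff_del:
  assumes "length xs = n + 1"
  shows "ce_diff scaleM bracket act n f xs =
     (\<Sum>i\<in>{..<n + 1}. scaleM ((- 1) ^ (n + (i + 1))) (act (xs ! i) (f (del i xs))))
   + (\<Sum>(i, j)\<in>{(i, j). i < j \<and> j < n + 1}.
        scaleM ((- 1) ^ ((i + 1) + (j + 1) + n + 1))
          (f (bracket (xs ! i) (del i xs ! (j - 1)) # del (j - 1) (del i xs))))"
proof -
  have "nths xs (- {i, j}) = del (j - 1) (del i xs)" and "xs ! j = del i xs ! (j - 1)"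
    if "(i, j) \<in> {(i, j). i < j \<and> j < n + 1}" for i j
    using that assms by (simp_all add: nths_Compl_pair nth_del_above)
  then show ?thesis
    using assms unfolding ce_diff_def nths_Compl_singleton
    by (auto intro!: arg_cong2[where f = "(+)"] sum.cong)
qed

section \<open>The comparison map on cochains\<close>

context rota_baxter_lie_representation
begin

abbreviation "bracket_star \<equiv> descendent_bracket scaleG bracket lam T"
abbreviation "act_star \<equiv> descendent_act act T TM"
abbreviation "E \<equiv> eps_coeff scaleM lam T"

lemma rb_Phi_pos:
  assumes "length xs = n" and "n > 0"
  shows "rb_Phi scaleM lam T TM n f xs = f (map T xs) - TM (E f xs)"
proof -
  interpret TMl: Vector_Spaces.linear scaleM scaleM TM by (rule TM_linear)
  let ?g = "\<lambda>I. scaleM (lam ^ (n - card I - 1)) (TM (f (apply_at T I xs)))"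
  let ?S = "\<lambda>k. {I. I \<subseteq> {..<n} \<and> card I = k}"
  have "(\<Sum>k\<in>{0..n - 1}. \<Sum>I\<in>?S k. scaleM (lam ^ (n - k - 1)) (TM (f (apply_at T I xs))))
      = (\<Sum>k\<in>{0..n - 1}. \<Sum>I\<in>?S k. ?g I)"
    by (intro sum.cong) auto
  also have "\<dots> = sum ?g (\<Union>k\<in>{0..n - 1}. ?S k)"
    by (rule sum.UNION_disjoint[symmetric]) auto
  also have "(\<Union>k\<in>{0..n - 1}. ?S k) = {I. I \<subset> {..<n}}"
  proof (intro set_eqI iffI)
    fix I assume "I \<in> {I. I \<subset> {..<n}}"
    then show "I \<in> (\<Union>k\<in>{0..n - 1}. ?S k)"
      using psubset_card_mono[of "{..<n}" I] by auto
  next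
    fix I assume "I \<in> (\<Union>k\<in>{0..n - 1}. ?S k)"
    then have "I \<subseteq> {..<n}" and "card I < n" using assms(2) by auto
    then show "I \<in> {I. I \<subset> {..<n}}" by auto
  qed
  also have "sum ?g {I. I \<subset> {..<n}} = TM (E f xs)"
    by (simp add: M.eps_coeff_eq_sum_proper_subsets TMl.sum TMl.scale assms(1))
  finally show ?thesis using assms by (simp add: rb_Phi_def)
qed

text \<open>
  In degree \<open>0\<close> the \<open>\<epsilon>\<close>-coefficient vanishes, so the same formula covers the identity of \<open>M\<close>.
\<close>

lemma rb_Phi_cochain:
  assumes "f \<in> ce_cochains scaleG scaleM n"
  shows "rb_Phi scaleM lam T TM n f xs = (if length xs = n then f (map T xs) - TM (E f xs) else 0)"
proof (cases "n = 0")
  case True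
  interpret TMl: Vector_Spaces.linear scaleM scaleM TM by (rule TM_linear)
  show ?thesis using True assms by (auto simp: rb_Phi_def ce_cochains_def TMl.zero)
next
  case False
  then show ?thesis using rb_Phi_pos[of xs n] by (auto simp: rb_Phi_def)
qed

lemma eps_coeff_linear:
  assumes "f \<in> ce_cochains scaleG scaleM (Suc (length ys))" and "i \<le> length ys"
  shows "Vector_Spaces.linear scaleG scaleM (\<lambda>x. E f (ins i x ys))"
proof -
  interpret Tl: Vector_Spaces.linear scaleG scaleG T by (rule T_linear)
  have add: "f (ins i (x + y) zs) = f (ins i x zs) + f (ins i y zs)"
    and scl: "f (ins i (scaleG c x) zs) = scaleM c (f (ins i x zs))"
    if "length zs = length ys" for x y c zs
  proof -
    interpret l: Vector_Spaces.linear scaleG scaleM "\<lambda>x. f (ins i x zs)"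
      by (rule cochain_linear) (use assms that in auto)
    show "f (ins i (x + y) zs) = f (ins i x zs) + f (ins i y zs)" by (rule l.add)
    show "f (ins i (scaleG c x) zs) = scaleM c (f (ins i x zs))" by (rule l.scale)
  qed
  have Eadd: "E (\<lambda>zs. f (ins i (x + y) zs)) ys = E (\<lambda>zs. f (ins i x zs)) ys + E (\<lambda>zs. f (ins i y zs)) ys"
    for x y
    by (subst M.eps_coeff_add[symmetric]) (rule eps_coeff_cong, rule add)
  have Escl: "E (\<lambda>zs. f (ins i (scaleG c x) zs)) ys = scaleM c (E (\<lambda>zs. f (ins i x zs)) ys)" for c x
    by (subst M.eps_coeff_scale[symmetric]) (rule eps_coeff_cong, rule scl)
  show ?thesis
    unfolding M.eps_coeff_ins[OF assms(2)]
    apply unfold_locales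
     apply (simp only: Tl.add Eadd add length_map M.scale_right_distrib add_ac)
    apply (simp only: Tl.scale Escl scl length_map M.scale_right_distrib M.scale_left_commute[of lam])
    done
qed

text \<open>
  Two equal arguments \<open>T x + \<epsilon> x\<close> produce the terms with \<open>T x\<close> twice or \<open>x\<close> twice, which vanish,
  and the two mixed terms, which cancel by antisymmetry.
\<close>

lemma eps_coeff_alternating:
  assumes "f \<in> ce_cochains scaleG scaleM (Suc (Suc (length zs)))" and "i \<le> j" and "j \<le> length zs"
  shows "E f (ins i x (ins j x zs)) = 0"
proof -
  define F where "F x y = (\<lambda>ys. f (ins i x (ins j y ys)))" for x y
  have alt: "F a a ys = 0" and anti: "F a b ys + F b a ys = 0" if "length ys = length zs" for a b ys
    unfolding F_def using assms that
    by (auto intro: cochain_alternating cochain_antisymmetric)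
  have E_alt: "E (F a a) zs = 0" for a
    using eps_coeff_cong[of zs "F a a" "\<lambda>ys. 0" scaleM lam T] alt by (simp add: M.eps_coeff_zero)
  have E_anti: "E (F a b) zs + E (F b a) zs = 0" for a b
    unfolding M.eps_coeff_add[symmetric]
    using eps_coeff_cong[of zs "\<lambda>ys. F a b ys + F b a ys" "\<lambda>ys. 0" scaleM lam T] anti by (simp add: M.eps_coeff_zero)
  show ?thesis
    using M.eps_coeff_ins_ins[of i zs j lam T f x x] assms(2,3)
      E_alt E_anti[of x "T x"] alt[of "map T zs"] anti[of "map T zs" x "T x"]
    unfolding F_def by simp
qed

lemma rb_Phi_in_cochains:
  assumes f: "f \<in> ce_cochains scaleG scaleM n"
  shows "rb_Phi scaleM lam T TM n f \<in> ce_cochains scaleG scaleM n"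
proof -
  interpret TMl: Vector_Spaces.linear scaleM scaleM TM by (rule TM_linear)
  interpret Tl: Vector_Spaces.linear scaleG scaleG T by (rule T_linear)
  note Phi = rb_Phi_cochain[OF f]
  have lin: "Vector_Spaces.linear scaleG scaleM (\<lambda>x. rb_Phi scaleM lam T TM n f (xs[i := x]))"
    if "length xs = n" "i < n" for xs i
  proof -
    define ys where "ys = del i xs"
    have n: "n = Suc (length ys)" and i: "i \<le> length ys"
      using that by (auto simp: ys_def length_del)
    interpret l1: Vector_Spaces.linear scaleG scaleM "\<lambda>x. f (ins i x (map T ys))"
      by (rule cochain_linear) (use f n i in auto)
    interpret l2: Vector_Spaces.linear scaleG scaleM "\<lambda>x. E f (ins i x ys)"
      by (rule eps_coeff_linear) (use f n i in auto)
    have "rb_Phi scaleM lam T TM n f (xs[i := x]) = f (ins i (T x) (map T ys)) - TM (E f (ins i x ys))" for x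
      using that by (simp add: Phi update_eq_ins ys_def[symmetric] n[symmetric] map_ins)
    then show ?thesis
      apply (simp only:)
      apply unfold_locales
       apply (simp only: Tl.add l1.add l2.add TMl.add add_diff_add)
      apply (simp only: Tl.scale l1.scale l2.scale TMl.scale M.scale_right_diff_distrib)
      done
  qed
  have alt: "rb_Phi scaleM lam T TM n f xs = 0"
    if xs: "length xs = n" and ij: "i < j" "j < n" and eq: "xs ! i = xs ! j" for xs i j
  proof -
    define zs where "zs = del (j - 1) (del i xs)"
    have len: "length (del i xs) = n - 1" using xs ij by (simp add: length_del)
    have n: "n = Suc (Suc (length zs))" using len ij by (simp add: zs_def length_del)
    have "xs = ins i (xs ! i) (ins (j - 1) (del i xs ! (j - 1)) zs)"
      unfolding zs_def using xs ij len by (simp add: ins_del)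
    then have xs_eq: "xs = ins i (xs ! i) (ins (j - 1) (xs ! i) zs)"
      using xs ij eq by (simp add: nth_del_above)
    have "E f xs = 0"
      by (subst xs_eq, rule eps_coeff_alternating) (use f n ij in auto)
    moreover have "f (map T xs) = 0"
      by (subst xs_eq, unfold map_ins, rule cochain_alternating) (use f n ij in auto)
    ultimately show ?thesis by (simp add: Phi TMl.zero)
  qed
  show ?thesis
    unfolding ce_cochains_def using lin alt by (auto simp: Phi)
qed

lemma rb_Phi_add:
  "rb_Phi scaleM lam T TM n (\<lambda>xs. f xs + h xs) =
    (\<lambda>xs. rb_Phi scaleM lam T TM n f xs + rb_Phi scaleM lam T TM n h xs)"
proof (cases "n = 0")
  case True
  then show ?thesis by (simp add: rb_Phi_def)
next
  case False
  interpret TMl: Vector_Spaces.linear scaleM scaleM TM by (rule TM_linear)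
  have "rb_Phi scaleM lam T TM n f xs = 0" if "length xs \<noteq> n" for f xs
    using False that by (simp add: rb_Phi_def)
  then show ?thesis
    using False rb_Phi_pos[of _ n] by (intro ext, case_tac "length xs = n") (simp_all add: M.eps_coeff_add TMl.add)
qed

lemma rb_Phi_scale:
  "rb_Phi scaleM lam T TM n (\<lambda>xs. scaleM c (f xs)) = (\<lambda>xs. scaleM c (rb_Phi scaleM lam T TM n f xs))"
proof (cases "n = 0")
  case True
  then show ?thesis by (simp add: rb_Phi_def)
next
  case False
  interpret TMl: Vector_Spaces.linear scaleM scaleM TM by (rule TM_linear)
  have "rb_Phi scaleM lam T TM n f xs = 0" if "length xs \<noteq> n" for f xs
    using False that by (simp add: rb_Phi_def)
  then show ?thesis
    using False rb_Phi_pos[of _ n]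
    by (intro ext, case_tac "length xs = n")
      (simp_all add: M.eps_coeff_scale TMl.scale M.scale_right_diff_distrib)
qed

section \<open>Compatibility with the differentials\<close>

text \<open>
  This is the \<open>\<epsilon>\<close>-part of \<open>(T x\<^sub>i + \<epsilon> x\<^sub>i) \<cdot> (f \<circ> T + \<epsilon> S f)\<close>, evaluated at the other arguments.
\<close>

lemma eps_coeff_action_term:
  assumes "i < length xs"
  shows "E (\<lambda>ys. act (ys ! i) (f (del i ys))) xs =
    act (T (xs ! i)) (E f (del i xs)) + scaleM lam (act (xs ! i) (E f (del i xs)))
    + act (xs ! i) (f (map T (del i xs)))"
proof -
  define x where "x = xs ! i"
  define zs where "zs = del i xs"
  have i: "i \<le> length zs" and xs: "xs = ins i x zs"
    using assms by (simp_all add: zs_def x_def length_del ins_del)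
  have "E (\<lambda>ys. act (ins i a ys ! i) (f (del i (ins i a ys)))) zs = act a (E f zs)" for a
  proof -
    have "E (\<lambda>ys. act (ins i a ys ! i) (f (del i (ins i a ys)))) zs = E (\<lambda>ys. act a (f ys)) zs"
      using i by (intro eps_coeff_cong) (simp add: nth_ins_same del_ins)
    then show ?thesis by (simp add: M.eps_coeff_hom act_linear_right)
  qed
  then show ?thesis
    using i unfolding x_def[symmetric] zs_def[symmetric] unfolding xs
    by (simp add: M.eps_coeff_ins nth_ins_same del_ins)
qed

lemma T_bracket_star: "T (bracket_star a b) = bracket (T a) (T b)"
  unfolding descendent_bracket_def by (rule rota_baxter[symmetric])

text \<open>
  The two bracketed arguments satisfy
  \<open>[T x\<^sub>i + \<epsilon> x\<^sub>i, T x\<^sub>j + \<epsilon> x\<^sub>j] = T z + \<epsilon> z\<close> with \<open>z = [x\<^sub>i, x\<^sub>j]\<^sub>\<star>\<close>, so expanding a bracket term of the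
  differential gives the same as expanding \<open>f\<close> at \<open>z\<close> and the other arguments.
\<close>

lemma eps_coeff_bracket_term:
  assumes f: "f \<in> ce_cochains scaleG scaleM (length xs - 1)" and ij: "i < j" "j < length xs"
  shows "E (\<lambda>ys. f (bracket (ys ! i) (del i ys ! (j - 1)) # del (j - 1) (del i ys))) xs =
    E f (bracket_star (xs ! i) (del i xs ! (j - 1)) # del (j - 1) (del i xs))"
proof -
  define k where "k = j - 1"
  define x where "x = xs ! i"
  define y where "y = del i xs ! k"
  define zs where "zs = del k (del i xs)"
  have len: "length (del i xs) = length xs - 1" using ij by (simp add: length_del)
  have xs: "xs = ins i x (ins k y zs)" and i: "i \<le> Suc (length zs)" and k: "k \<le> length zs"
    and n: "length xs - 1 = Suc (length zs)"
    using ij len by (simp_all add: x_def y_def zs_def k_def ins_del length_del)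
  have add: "f ((a + b) # ys) = f (a # ys) + f (b # ys)"
    and scl: "f (scaleG c a # ys) = scaleM c (f (a # ys))"
    if "length ys = length zs" for a b c ys
  proof -
    interpret l: Vector_Spaces.linear scaleG scaleM "\<lambda>x. f (ins 0 x ys)"
      by (rule cochain_linear) (use f n that in auto)
    show "f ((a + b) # ys) = f (a # ys) + f (b # ys)" using l.add by simp
    show "f (scaleG c a # ys) = scaleM c (f (a # ys))" using l.scale by simp
  qed
  have star: "f (bracket_star a b # ys) =
      f (bracket a (T b) # ys) + f (bracket (T a) b # ys) + scaleM lam (f (bracket a b # ys))"
    if "length ys = length zs" for a b ys
    unfolding descendent_bracket_def using that by (simp add: add scl)
  have E_star: "E (\<lambda>ys. f (bracket_star x y # ys)) zs =
      E (\<lambda>ys. f (bracket x (T y) # ys)) zs + E (\<lambda>ys. f (bracket (T x) y # ys)) zs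
      + scaleM lam (E (\<lambda>ys. f (bracket x y # ys)) zs)"
  proof -
    have "E (\<lambda>ys. f (bracket_star x y # ys)) zs =
        E (\<lambda>ys. f (bracket x (T y) # ys) + f (bracket (T x) y # ys) + scaleM lam (f (bracket x y # ys))) zs"
      by (rule eps_coeff_cong) (rule star)
    then show ?thesis by (simp add: M.eps_coeff_add M.eps_coeff_scale)
  qed
  define B where "B = (\<lambda>ys. f (bracket (ys ! i) (del i ys ! k) # del k (del i ys)))"
  have B: "B (ins i a (ins k b ys)) = f (bracket a b # ys)" if "length ys = length zs" for a b ys
    using that i k unfolding B_def by (simp add: nth_ins_same del_ins)
  have EB: "E (\<lambda>ys. B (ins i a (ins k b ys))) zs = E (\<lambda>ys. f (bracket a b # ys)) zs" for a b
    by (rule eps_coeff_cong) (rule B)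
  have "E B (ins i x (ins k y zs)) = E f (bracket_star x y # zs)"
    by (simp add: M.eps_coeff_ins_ins[OF i k] EB B E_star star T_bracket_star)
  then show ?thesis
    unfolding B_def xs[symmetric] unfolding x_def y_def zs_def k_def .
qed

lemma eps_coeff_ce_diff:
  assumes f: "f \<in> ce_cochains scaleG scaleM n" and xs: "length xs = n + 1"
  shows "E (ce_diff scaleM bracket act n f) xs =
     (\<Sum>i\<in>{..<n + 1}. scaleM ((- 1) ^ (n + (i + 1)))
        (act (T (xs ! i)) (E f (del i xs)) + scaleM lam (act (xs ! i) (E f (del i xs)))
          + act (xs ! i) (f (map T (del i xs)))))
   + (\<Sum>(i, j)\<in>{(i, j). i < j \<and> j < n + 1}.
        scaleM ((- 1) ^ ((i + 1) + (j + 1) + n + 1))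
          (E f (bracket_star (xs ! i) (del i xs ! (j - 1)) # del (j - 1) (del i xs))))"
proof -
  let ?P = "{(i, j). i < j \<and> j < n + 1}"
  let ?s = "\<lambda>i j. (- 1) ^ ((i + 1) + (j + 1) + n + 1)"
  let ?A = "\<lambda>i ys. act (ys ! i) (f (del i ys))"
  let ?B = "\<lambda>i j ys. f (bracket (ys ! i) (del i ys ! (j - 1)) # del (j - 1) (del i ys))"
  have fin: "finite ?P" by (rule finite_subset[of _ "{..<n+1} \<times> {..<n+1}"]) auto
  have "E (ce_diff scaleM bracket act n f) xs =
      E (\<lambda>ys. (\<Sum>i\<in>{..<n + 1}. scaleM ((- 1) ^ (n + (i + 1))) (?A i ys))
            + (\<Sum>p\<in>?P. scaleM (?s (fst p) (snd p)) (?B (fst p) (snd p) ys))) xs"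
    by (rule eps_coeff_cong) (use xs in \<open>simp add: ce_diff_del case_prod_beta\<close>)
  also have "\<dots> = (\<Sum>i\<in>{..<n + 1}. scaleM ((- 1) ^ (n + (i + 1))) (E (?A i) xs))
            + (\<Sum>p\<in>?P. scaleM (?s (fst p) (snd p)) (E (?B (fst p) (snd p)) xs))"
    using fin by (simp only: M.eps_coeff_add M.eps_coeff_sum M.eps_coeff_scale finite_lessThan)
  also have "(\<Sum>i\<in>{..<n + 1}. scaleM ((- 1) ^ (n + (i + 1))) (E (?A i) xs)) =
     (\<Sum>i\<in>{..<n + 1}. scaleM ((- 1) ^ (n + (i + 1)))
        (act (T (xs ! i)) (E f (del i xs)) + scaleM lam (act (xs ! i) (E f (del i xs)))
          + act (xs ! i) (f (map T (del i xs)))))"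
    using xs by (intro sum.cong) (simp_all add: eps_coeff_action_term)
  also have "(\<Sum>p\<in>?P. scaleM (?s (fst p) (snd p)) (E (?B (fst p) (snd p)) xs)) =
      (\<Sum>(i, j)\<in>?P. scaleM (?s i j)
          (E f (bracket_star (xs ! i) (del i xs ! (j - 1)) # del (j - 1) (del i xs))))"
  proof (intro sum.cong refl)
    fix p assume "p \<in> ?P"
    then obtain i j where p: "p = (i, j)" and ij: "i < j" "j < length xs" using xs by auto
    show "scaleM (?s (fst p) (snd p)) (E (?B (fst p) (snd p)) xs) =
      (case p of (i, j) \<Rightarrow> scaleM (?s i j)
          (E f (bracket_star (xs ! i) (del i xs ! (j - 1)) # del (j - 1) (del i xs))))"
      using eps_coeff_bracket_term[OF _ ij, of f] f xs unfolding p by simp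
  qed
  finally show ?thesis .
qed

text \<open>
  Equivariance of \<open>m + \<epsilon> m' \<mapsto> m - T\<^sub>M m'\<close>: the right-hand side is the image of
  \<open>(T a + \<epsilon> a) \<cdot> (m + \<epsilon> m')\<close>.
\<close>

lemma act_star_minus_TM:
  "act_star a (m - TM m') = act (T a) m - TM (act (T a) m' + scaleM lam (act a m') + act a m)"
proof -
  interpret TMl: Vector_Spaces.linear scaleM scaleM TM by (rule TM_linear)
  interpret ar: Vector_Spaces.linear scaleM scaleM "\<lambda>m. act a m" for a by (rule act_linear_right)
  show ?thesis
    by (simp add: descendent_act_def ar.diff TMl.diff TMl.add rota_baxter_act)
qed

lemma rb_Phi_ce_diff:
  assumes f: "f \<in> ce_cochains scaleG scaleM n"
  shows "rb_Phi scaleM lam T TM (n + 1) (ce_diff scaleM bracket act n f) =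
    ce_diff scaleM bracket_star act_star n (rb_Phi scaleM lam T TM n f)"
proof
  fix xs
  interpret TMl: Vector_Spaces.linear scaleM scaleM TM by (rule TM_linear)
  let ?P = "{(i, j). i < j \<and> j < n + 1}"
  let ?s = "\<lambda>i j. (- 1) ^ ((i + 1) + (j + 1) + n + 1)"
  let ?Phi = "rb_Phi scaleM lam T TM n f"
  show "rb_Phi scaleM lam T TM (n + 1) (ce_diff scaleM bracket act n f) xs =
    ce_diff scaleM bracket_star act_star n ?Phi xs"
  proof (cases "length xs = n + 1")
    case False
    then show ?thesis by (simp add: rb_Phi_def ce_diff_def)
  next
    case xs: True
    \<comment> \<open>The element \<open>a i + \<epsilon> a' i\<close> is \<open>(T x\<^sub>i + \<epsilon> x\<^sub>i) \<cdot> (f \<circ> T + \<epsilon> S f)\<close> at the other arguments.\<close>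
    define a where "a i = act (T (xs ! i)) (f (map T (del i xs)))" for i
    define a' where "a' i = act (T (xs ! i)) (E f (del i xs)) + scaleM lam (act (xs ! i) (E f (del i xs)))
          + act (xs ! i) (f (map T (del i xs)))" for i
    define zs where "zs i j = bracket_star (xs ! i) (del i xs ! (j - 1)) # del (j - 1) (del i xs)" for i j
    have Tdiff: "ce_diff scaleM bracket act n f (map T xs) =
        (\<Sum>i\<in>{..<n + 1}. scaleM ((- 1) ^ (n + (i + 1))) (a i))
      + (\<Sum>(i, j)\<in>?P. scaleM (?s i j) (f (map T (zs i j))))"
    proof -
      have len: "length (map T xs) = n + 1" using xs by simp
      have nth: "del i (map T xs) ! (j - Suc 0) = T (del i xs ! (j - Suc 0))" if "i < j" "j < n + 1" for i j
        using that xs unfolding map_del[symmetric] by (subst nth_map) (auto simp: length_del)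
      show ?thesis
        unfolding ce_diff_del[OF len] a_def zs_def
        by (intro arg_cong2[where f = "(+)"] sum.cong refl)
          (use xs in \<open>auto simp: map_del nth T_bracket_star\<close>)
    qed
    have Phi_act: "act_star (xs ! i) (?Phi (del i xs)) = a i - TM (a' i)" if "i < n + 1" for i
      using that xs by (simp add: rb_Phi_cochain[OF f] length_del act_star_minus_TM a_def a'_def)
    have Phi_bracket: "?Phi (zs i j) = f (map T (zs i j)) - TM (E f (zs i j))" if "(i, j) \<in> ?P" for i j
    proof -
      have "length (zs i j) = n" using that xs by (auto simp: zs_def length_del)
      then show ?thesis by (simp add: rb_Phi_cochain[OF f])
    qed
    have "ce_diff scaleM bracket_star act_star n ?Phi xs =
        (\<Sum>i\<in>{..<n + 1}. scaleM ((- 1) ^ (n + (i + 1))) (a i - TM (a' i)))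
      + (\<Sum>(i, j)\<in>?P. scaleM (?s i j) (f (map T (zs i j)) - TM (E f (zs i j))))"
      unfolding ce_diff_del[OF xs] zs_def[symmetric]
      by (intro arg_cong2[where f = "(+)"] sum.cong refl) (auto simp: Phi_act Phi_bracket)
    also have "\<dots> = ce_diff scaleM bracket act n f (map T xs) - TM (E (ce_diff scaleM bracket act n f) xs)"
      unfolding Tdiff eps_coeff_ce_diff[OF f xs] a'_def[symmetric] zs_def[symmetric]
      by (simp only: case_prod_unfold TMl.add TMl.sum TMl.scale M.scale_right_diff_distrib sum_subtractf
          add_diff_add)
    also have "\<dots> = rb_Phi scaleM lam T TM (n + 1) (ce_diff scaleM bracket act n f) xs"
      by (rule rb_Phi_pos[symmetric]) (use xs in auto)
    finally show ?thesis by simp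
  qed
qed

end

theorem proposition3p8:
  fixes scaleG :: "'k::field_char_0 \<Rightarrow> 'g::ab_group_add \<Rightarrow> 'g"
    and bracket :: "'g \<Rightarrow> 'g \<Rightarrow> 'g"
    and lam :: 'k and T :: "'g \<Rightarrow> 'g"
    and scaleM :: "'k \<Rightarrow> 'm::ab_group_add \<Rightarrow> 'm"
    and act :: "'g \<Rightarrow> 'm \<Rightarrow> 'm" and TM :: "'m \<Rightarrow> 'm"
  assumes "rota_baxter_lie_algebra scaleG bracket lam T"
    and "rota_baxter_lie_representation scaleG bracket lam T scaleM act TM"
  shows "cochain_map scaleM
    (ce_cochains scaleG scaleM) (ce_diff scaleM bracket act)
    (ce_cochains scaleG scaleM)
    (ce_diff scaleM (descendent_bracket scaleG bracket lam T) (descendent_act act T TM))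
    (rb_Phi scaleM lam T TM)"
proof -
  interpret rota_baxter_lie_representation scaleG bracket lam T scaleM act TM by fact
  show ?thesis
    unfolding cochain_map_def
    using rb_Phi_in_cochains rb_Phi_add rb_Phi_scale rb_Phi_ce_diff by blast
qed

end
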